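(* Let $\{\Theta^t\}_{t\in\mathbb{R}_+}$ be a birth-and-growth process in $\mathbb{R}^d$, $d\ge2$, belonging to the class $\mathcal{G}$, with nucleation process $N$ having intensity measure $\Lambda$, mean extended volume density $V_{\rm ex}(t,x)$ and causal cones $\mathcal{C}(t,x)$. Then, for all $t\in\mathbb{R}_+$, $$V_{\rm ex}(t,x)=\Lambda(\mathcal{C}(t,x))\qquad\text{for }\mathcal{H}^d\text{-a.e. }x\in\mathbb{R}^d.$$
   Context: Throughout $d\ge2$, $\mathbb{R}_+=[0,\infty)$, $\mathcal{H}^n$ is $n$-dimensional Hausdorff measure, and $\mathcal{H}^d$ is Lebesgue measure on $\mathbb{R}^d$. All random objects live on one probability space $(\Omega,\mathfrak{F},\mathbb{P})$. Nucleation process. $N=\sum_{j\ge1}\delta_{(T_j,X_j)}$ is a marked point process in $\mathbb{R}_+$ with marks in $\mathbb{R}^d$: $T_j\ge 0$ is the random birth time and $X_j$ the random location of the $j$-th nucleus. The marginal process is $\widetilde N(\cdot):=N(\,\cdot\times\mathbb{R}^d)$. The intensity measures are $\Lambda(B\times A):=\mathbb{E}[N(B\times A)]$ and $\widetilde\Lambda(B):=\mathbb{E}[\widetilde N(B)]$, with the decomposition $\Lambda(dt\times dx)=\widetilde\Lambda(dt)\,Q(t,dx)$, where $Q(t,\cdot)$ is a probability measure on $\mathbb{R}^d$ for each $t$ (the mark distribution at time $t$). Growth model. For $t\ge s$, $\Theta_s^t(y)$ denotes the grain (closed set) grown up to time $t$ from a nucleus born at time $s$ at the point $y$; $\Theta_s^t(y)=\emptyset$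 for $t<s$. The normal growth model is assumed: at $\mathcal{H}^{d-1}$-a.e. point $x\in\partial\Theta_{s}^t(y)$ growth occurs with normal velocity $v(t,x)=G(t,x)n(t,x)$, where $n(t,x)$ is the unit outer normal to the grain at $x$ and $G$ is a given deterministic growth field with $0<g_0\le G(t,x)\le G_0<\infty$ for all $(t,x)\in\mathbb{R}_+\times\mathbb{R}^d$ (constants $g_0,G_0$). $G$ is assumed sufficiently regular that the evolution problem for the growth front $\partial\Theta_{s}^t(y)$ is well posed; in particular the grains are random closed sets whose boundaries have locally finite $\mathcal{H}^{d-1}$-measure a.s., and the causal cone $$\mathcal{C}(t,x):=\{(s,y)\in[0,t]\times\mathbb{R}^d:\ x\in\Theta_s^t(y)\}$$ is well defined for all $(t,x)$. Birth-and-growth process: the family of random closed sets $\Theta^t:=\bigcup_{T_j\le t}\Theta_{T_j}^t(X_j)$, $t\in\mathbb{R}_+$. Mean extended volume density: $V_{\rm ex}(t,\cdot)$ is the density with respect to $\mathcal{H}^d$ of the mean extended volume measure at time $t$, i.e. for every Borel $A\subset\mathbb{R}^d$, $$\mathbb{E}\Big[\sum_{j:\,T_j\le t}\mathcal{H}^d(\Theta_{T_j}^t(X_j)\cap A)\Big]=\int_A V_{\rm ex}(t,x)\,dx.$$ Class $\mathcal{G}$: the family of all birth-and-growth processes $\{\Theta^t\}_t$ with growth model as described such that: (i) for every $t\in\mathbb{R}_+$ and every bounded Borel set $A\subset\mathbb{R}^d$ with $\mathcal{H}^d(\partial A)=0$, $$\lim_{r\downarrow0}\frac{\mathbb{E}[\mathcal{H}^d((\Theta^t_r\setminus\Theta^t)\cap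 A)]}{r}=\mathbb{E}[\mathcal{H}^{d-1}(\partial\Theta^t\cap A)],$$ where $\Theta^t_r:=\{x\in\mathbb{R}^d:\exists y\in\Theta^t,\ |x-y|\le r\}$; (A1) $\mathbb{E}\big[\widetilde N([t,t+\Delta t])\,\mathbf{1}_{\{\widetilde N([t,t+\Delta t])\ge2\}}\big]=o(\Delta t)$ as $\Delta t\downarrow 0$, for all $t>0$; (A2) $\widetilde\Lambda$ is locally finite and has a density $\lambda$ with respect to Lebesgue measure, and for all $t>0$ the mark distribution $Q(t,\cdot)$ has a density $q(t,\cdot)$ on $\mathbb{R}^d$ with respect to $\mathcal{H}^d$. *)

theory Defs
  imports "HOL-Probability.Probability"
begin

text \<open>The \<open>k\<close>-dimensional Hausdorff (outer) measure, normalised so that in dimension \<open>d\<close> the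
  \<open>d\<close>-dimensional measure is Lebesgue measure. Since \<open>0 ^ 0 = 1\<close>, empty covering sets have to be
  given size \<open>0\<close> explicitly when \<open>k = 0\<close>.\<close>

definition hausdorff_size :: "nat \<Rightarrow> 'a::metric_space set \<Rightarrow> ennreal" where
  "hausdorff_size k U =
     (if U = {} then 0 else ennreal (unit_ball_vol (real k) * (diameter U / 2) ^ k))"

definition hausdorff_premeasure :: "nat \<Rightarrow> real \<Rightarrow> 'a::metric_space set \<Rightarrow> ennreal" where
  "hausdorff_premeasure k \<delta> A =
     (INF U \<in> {U :: nat \<Rightarrow> 'a set. A \<subseteq> (\<Union>i. U i) \<and> (\<forall>i. bounded (U i) \<and> diameter (U i) \<le> \<delta>)}.
        \<Sum>i. hausdorff_size k (U i))"

definition hausdorff_measure :: "nat \<Rightarrow> 'a::metric_space set \<Rightarrow> ennreal" where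
  "hausdorff_measure k A = (SUP \<delta> \<in> {0<..}. hausdorff_premeasure k \<delta> A)"

definition random_closed_set :: "'w measure \<Rightarrow> ('w \<Rightarrow> 'a::topological_space set) \<Rightarrow> bool" where
  "random_closed_set M F \<longleftrightarrow>
     (AE \<omega> in M. closed (F \<omega>)) \<and>
     (\<forall>K. compact K \<longrightarrow> {\<omega> \<in> space M. F \<omega> \<inter> K \<noteq> {}} \<in> sets M)"

definition enlargement :: "'a::metric_space set \<Rightarrow> real \<Rightarrow> 'a set" where
  "enlargement A r = {x. \<exists>y\<in>A. dist x y \<le> r}"


text \<open>Birth times take values in \<open>[0, \<infinity>]\<close>: \<open>T j \<omega> = \<infinity>\<close> means that the realisation \<open>\<omega>\<close> has no
  \<open>j\<close>-th nucleus, so that the number of nuclei may be finite. As \<open>enn2real \<infinity> = 0\<close>, such indices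
  are excluded explicitly below.\<close>

definition nucleation ::
  "(nat \<Rightarrow> 'w \<Rightarrow> ennreal) \<Rightarrow> (nat \<Rightarrow> 'w \<Rightarrow> 'a) \<Rightarrow> 'w \<Rightarrow> (real \<times> 'a::euclidean_space) measure" where
  "nucleation T X \<omega> =
     distr (count_space {j. T j \<omega> < \<infinity>}) borel (\<lambda>j. (enn2real (T j \<omega>), X j \<omega>))"

definition marginal_process ::
  "(nat \<Rightarrow> 'w \<Rightarrow> ennreal) \<Rightarrow> (nat \<Rightarrow> 'w \<Rightarrow> 'a::euclidean_space) \<Rightarrow> 'w \<Rightarrow> real measure" where
  "marginal_process T X \<omega> = distr (nucleation T X \<omega>) borel fst"

definition intensity ::
  "'w measure \<Rightarrow> (nat \<Rightarrow> 'w \<Rightarrow> ennreal) \<Rightarrow> (nat \<Rightarrow> 'w \<Rightarrow> 'a) \<Rightarrow> (real \<times> 'a::euclidean_space) measure"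
  where
  "intensity M T X = measure_of UNIV (sets borel) (\<lambda>B. \<integral>\<^sup>+\<omega>. emeasure (nucleation T X \<omega>) B \<partial>M)"

definition marginal_intensity ::
  "'w measure \<Rightarrow> (nat \<Rightarrow> 'w \<Rightarrow> ennreal) \<Rightarrow> (nat \<Rightarrow> 'w \<Rightarrow> 'a::euclidean_space) \<Rightarrow> real measure" where
  "marginal_intensity M T X =
     measure_of UNIV (sets borel) (\<lambda>B. \<integral>\<^sup>+\<omega>. emeasure (marginal_process T X \<omega>) B \<partial>M)"

locale marked_point_process = prob_space M for M :: "'w measure" +
  fixes T :: "nat \<Rightarrow> 'w \<Rightarrow> ennreal" and X :: "nat \<Rightarrow> 'w \<Rightarrow> 'a::euclidean_space"
  assumes measurable_T: "\<And>j. T j \<in> borel_measurable M"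
    and measurable_X: "\<And>j. X j \<in> borel_measurable M"
    and locally_finite: "AE \<omega> in M. \<forall>t::real. finite {j. T j \<omega> \<le> ennreal t}"
begin

lemma emeasure_nucleation:
  assumes "B \<in> sets borel"
  shows "emeasure (nucleation T X \<omega>) B =
    (\<Sum>j. indicator {\<omega>. T j \<omega> < \<infinity> \<and> (enn2real (T j \<omega>), X j \<omega>) \<in> B} \<omega>)"
proof -
  let ?J = "{j. T j \<omega> < \<infinity> \<and> (enn2real (T j \<omega>), X j \<omega>) \<in> B}"
  have "emeasure (nucleation T X \<omega>) B = emeasure (count_space {j. T j \<omega> < \<infinity>}) ?J"
    unfolding nucleation_def using assms
    by (subst emeasure_distr) (auto intro!: arg_cong[where f = "emeasure _"])
  also have "\<dots> = emeasure (count_space UNIV) ?J"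
    by (subst (1 2) emeasure_count_space) auto
  also have "\<dots> = (\<integral>\<^sup>+j. indicator ?J j \<partial>count_space UNIV)"
    by simp
  also have "\<dots> = (\<Sum>j. indicator ?J j)"
    by (rule nn_integral_count_space_nat)
  finally show ?thesis
    by (simp add: indicator_def)
qed

lemma measurable_emeasure_nucleation:
  assumes [measurable]: "B \<in> sets borel"
  shows "(\<lambda>\<omega>. emeasure (nucleation T X \<omega>) B) \<in> borel_measurable M"
proof -
  note measurable_T[measurable] measurable_X[measurable]
  have "(\<lambda>\<omega>. \<Sum>j. indicator {\<omega> \<in> space M. T j \<omega> < \<infinity> \<and> (enn2real (T j \<omega>), X j \<omega>) \<in> B} \<omega> :: ennreal)
    \<in> borel_measurable M"
    by measurable
  then show ?thesis
    by (rule measurable_cong[THEN iffD1, rotated])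
       (auto simp: emeasure_nucleation indicator_def intro!: suminf_cong)
qed

lemma emeasure_intensity:
  assumes "B \<in> sets borel"
  shows "emeasure (intensity M T X) B = (\<integral>\<^sup>+\<omega>. emeasure (nucleation T X \<omega>) B \<partial>M)"
proof (rule emeasure_measure_of[OF intensity_def])
  show "countably_additive (sets (intensity M T X))
      (\<lambda>B. \<integral>\<^sup>+\<omega>. emeasure (nucleation T X \<omega>) B \<partial>M)"
  proof (rule countably_additiveI)
    fix A :: "nat \<Rightarrow> (real \<times> 'a) set"
    assume "range A \<subseteq> sets (intensity M T X)" and A: "disjoint_family A"
    then have borel: "range A \<subseteq> sets borel"
      using sets.sigma_sets_eq[of "borel :: (real \<times> 'a) measure"] by (simp add: intensity_def)
    have "(\<Sum>i. \<integral>\<^sup>+\<omega>. emeasure (nucleation T X \<omega>) (A i) \<partial>M) =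
      (\<integral>\<^sup>+\<omega>. (\<Sum>i. emeasure (nucleation T X \<omega>) (A i)) \<partial>M)"
      using borel by (intro nn_integral_suminf[symmetric] measurable_emeasure_nucleation) auto
    also have "\<dots> = (\<integral>\<^sup>+\<omega>. emeasure (nucleation T X \<omega>) (\<Union>i. A i) \<partial>M)"
      using borel A by (intro nn_integral_cong suminf_emeasure) (auto simp: nucleation_def)
    finally show "(\<Sum>i. \<integral>\<^sup>+\<omega>. emeasure (nucleation T X \<omega>) (A i) \<partial>M) =
      (\<integral>\<^sup>+\<omega>. emeasure (nucleation T X \<omega>) (\<Union>i. A i) \<partial>M)" .
  qed
  show "B \<in> sets (intensity M T X)"
    using assms sets.sigma_sets_eq[of "borel :: (real \<times> 'a) measure"] by (simp add: intensity_def)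
qed (auto simp: positive_def)

lemma emeasure_marginal_process:
  assumes "B \<in> sets borel"
  shows "emeasure (marginal_process T X \<omega>) B = emeasure (nucleation T X \<omega>) (B \<times> UNIV)"
proof -
  have "fst \<in> measurable (nucleation T X \<omega>) borel"
    by (simp add: nucleation_def borel_prod[symmetric])
  then show ?thesis
    using assms unfolding marginal_process_def
    by (subst emeasure_distr) (auto simp: nucleation_def intro!: arg_cong[where f = "emeasure _"])
qed

end


text \<open>Exterior unit normal in the sense of Federer: the blow-ups of \<open>K\<close> at \<open>x\<close> converge to the
  half-space \<open>{z. (z - x) \<bullet> n \<le> 0}\<close>. Such an \<open>n\<close> is unique if it exists.\<close>

definition outer_unit_normal :: "'a::euclidean_space set \<Rightarrow> 'a \<Rightarrow> 'a \<Rightarrow> bool" where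
  "outer_unit_normal K x n \<longleftrightarrow>
     norm n = 1 \<and>
     ((\<lambda>r. measure lborel (K \<inter> {z. (z - x) \<bullet> n > 0} \<inter> ball x r) / r ^ DIM('a)) \<longlongrightarrow> 0) (at_right 0) \<and>
     ((\<lambda>r. measure lborel ((- K) \<inter> {z. (z - x) \<bullet> n < 0} \<inter> ball x r) / r ^ DIM('a)) \<longlongrightarrow> 0) (at_right 0)"

definition signed_dist :: "'a::metric_space set \<Rightarrow> 'a \<Rightarrow> real" where
  "signed_dist K x = infdist x K - infdist x (- K)"

text \<open>The normal velocity of the front of a moving set \<open>K\<close> (defined for times in \<open>I\<close>) at the point
  \<open>x\<close> of \<open>frontier (K t)\<close> is \<open>c n\<close>, where \<open>n\<close> is the outer unit normal and \<open>- c\<close> is the time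
  derivative of the signed distance from \<open>x\<close> to the front (negative inside the set).\<close>

definition front_velocity ::
  "(real \<Rightarrow> 'a::euclidean_space set) \<Rightarrow> real set \<Rightarrow> real \<Rightarrow> 'a \<Rightarrow> 'a \<Rightarrow> bool" where
  "front_velocity K I t x v \<longleftrightarrow>
     (\<exists>n c. outer_unit_normal (K t) x n \<and> v = c *\<^sub>R n \<and>
        ((\<lambda>u. signed_dist (K u) x) has_real_derivative - c) (at t within I))"

definition causal_cone ::
  "(real \<Rightarrow> real \<Rightarrow> 'a \<Rightarrow> 'a set) \<Rightarrow> real \<Rightarrow> 'a \<Rightarrow> (real \<times> 'a) set" where
  "causal_cone \<Theta> t x = {(s, y). 0 \<le> s \<and> s \<le> t \<and> x \<in> \<Theta> s t y}"

text \<open>\<open>\<Theta> s t y\<close> is the grain at time \<open>t\<close> that was born at time \<open>s\<close> at the point \<open>y\<close>. The exceptional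
  set in the velocity condition is null for the \<open>(d - 1)\<close>-dimensional Hausdorff measure. Of the
  regularity of \<open>G\<close> (well-posedness of the front evolution) only its consequences are recorded: here
  that the causal cones are Borel, and in the next locale that the grains are random closed sets
  with boundaries of locally finite measure.\<close>

locale normal_growth =
  fixes \<Theta> :: "real \<Rightarrow> real \<Rightarrow> 'a::euclidean_space \<Rightarrow> 'a set" and G :: "real \<Rightarrow> 'a \<Rightarrow> real"
  assumes growth_bounds: "\<exists>g\<^sub>0 G\<^sub>0. 0 < g\<^sub>0 \<and> (\<forall>t\<ge>0. \<forall>x. g\<^sub>0 \<le> G t x \<and> G t x \<le> G\<^sub>0)"
    and grain_closed: "\<And>s t y. 0 \<le> s \<Longrightarrow> s \<le> t \<Longrightarrow> closed (\<Theta> s t y)"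
    and grain_unborn: "\<And>s t y. 0 \<le> s \<Longrightarrow> t < s \<Longrightarrow> \<Theta> s t y = {}"
    and grain_birth: "\<And>s y. 0 \<le> s \<Longrightarrow> \<Theta> s s y = {y}"
    and normal_velocity: "\<And>s t y. 0 \<le> s \<Longrightarrow> s \<le> t \<Longrightarrow>
      hausdorff_measure (DIM('a) - 1)
        {x \<in> frontier (\<Theta> s t y).
          \<not> (\<exists>n. outer_unit_normal (\<Theta> s t y) x n \<and>
                 front_velocity (\<lambda>u. \<Theta> s u y) {s..} t x (G t x *\<^sub>R n))} = 0"
    and causal_cone_borel: "\<And>t x. 0 \<le> t \<Longrightarrow> causal_cone \<Theta> t x \<in> sets borel"

definition grain ::
  "(nat \<Rightarrow> 'w \<Rightarrow> ennreal) \<Rightarrow> (nat \<Rightarrow> 'w \<Rightarrow> 'a) \<Rightarrow> (real \<Rightarrow> real \<Rightarrow> 'a \<Rightarrow> 'a set) \<Rightarrow>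
     nat \<Rightarrow> real \<Rightarrow> 'w \<Rightarrow> 'a set" where
  "grain T X \<Theta> j t \<omega> =
     (if T j \<omega> \<le> ennreal t then \<Theta> (enn2real (T j \<omega>)) t (X j \<omega>) else {})"

definition grain_union ::
  "(nat \<Rightarrow> 'w \<Rightarrow> ennreal) \<Rightarrow> (nat \<Rightarrow> 'w \<Rightarrow> 'a) \<Rightarrow> (real \<Rightarrow> real \<Rightarrow> 'a \<Rightarrow> 'a set) \<Rightarrow>
     real \<Rightarrow> 'w \<Rightarrow> 'a set" where
  "grain_union T X \<Theta> t \<omega> = (\<Union>j\<in>{j. T j \<omega> \<le> ennreal t}. grain T X \<Theta> j t \<omega>)"

definition mean_extended_volume_density ::
  "'w measure \<Rightarrow> (nat \<Rightarrow> 'w \<Rightarrow> ennreal) \<Rightarrow> (nat \<Rightarrow> 'w \<Rightarrow> 'a) \<Rightarrow>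
     (real \<Rightarrow> real \<Rightarrow> 'a::euclidean_space \<Rightarrow> 'a set) \<Rightarrow> real \<Rightarrow> ('a \<Rightarrow> ennreal) \<Rightarrow> bool" where
  "mean_extended_volume_density M T X \<Theta> t V \<longleftrightarrow>
     V \<in> borel_measurable borel \<and>
     (\<forall>A \<in> sets borel.
        (\<integral>\<^sup>+\<omega>. (\<Sum>j. emeasure lborel (grain T X \<Theta> j t \<omega> \<inter> A)) \<partial>M) = (\<integral>\<^sup>+x\<in>A. V x \<partial>lborel))"

locale birth_and_growth =
  marked_point_process M T X + normal_growth \<Theta> G
  for M :: "'w measure" and T :: "nat \<Rightarrow> 'w \<Rightarrow> ennreal" and X :: "nat \<Rightarrow> 'w \<Rightarrow> 'a::euclidean_space"
    and \<Theta> :: "real \<Rightarrow> real \<Rightarrow> 'a \<Rightarrow> 'a set" and G :: "real \<Rightarrow> 'a \<Rightarrow> real" +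
  assumes grain_random_closed: "\<And>j t. 0 \<le> t \<Longrightarrow> random_closed_set M (grain T X \<Theta> j t)"
    and grain_boundary: "\<And>j t. 0 \<le> t \<Longrightarrow>
      AE \<omega> in M. \<forall>K. compact K \<longrightarrow>
        hausdorff_measure (DIM('a) - 1) (frontier (grain T X \<Theta> j t \<omega>) \<inter> K) < \<infinity>"
begin

lemma random_closed_set_grain_union:
  assumes "0 \<le> t"
  shows "random_closed_set M (grain_union T X \<Theta> t)"
  unfolding random_closed_set_def
proof (intro conjI allI impI)
  have "AE \<omega> in M. \<forall>j. closed (grain T X \<Theta> j t \<omega>)"
    using grain_random_closed[OF assms] by (auto simp: AE_all_countable random_closed_set_def)
  with locally_finite show "AE \<omega> in M. closed (grain_union T X \<Theta> t \<omega>)"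
    by eventually_elim (auto simp: grain_union_def intro!: closed_UN)
next
  fix K :: "'a set" assume K: "compact K"
  have "{\<omega> \<in> space M. grain_union T X \<Theta> t \<omega> \<inter> K \<noteq> {}} =
    (\<Union>j. {\<omega> \<in> space M. grain T X \<Theta> j t \<omega> \<inter> K \<noteq> {}})"
    by (auto simp: grain_union_def grain_def split: if_splits)
  also have "\<dots> \<in> sets M"
    using grain_random_closed[OF assms] K by (auto simp: random_closed_set_def)
  finally show "{\<omega> \<in> space M. grain_union T X \<Theta> t \<omega> \<inter> K \<noteq> {}} \<in> sets M" .
qed

end

locale class_G =
  birth_and_growth M T X \<Theta> G
  for M :: "'w measure" and T :: "nat \<Rightarrow> 'w \<Rightarrow> ennreal" and X :: "nat \<Rightarrow> 'w \<Rightarrow> 'a::euclidean_space"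
    and \<Theta> :: "real \<Rightarrow> real \<Rightarrow> 'a \<Rightarrow> 'a set" and G :: "real \<Rightarrow> 'a \<Rightarrow> real" +
  fixes Q :: "real \<Rightarrow> 'a measure"
  assumes mark_kernel: "Q \<in> measurable (restrict_space borel {0..}) (prob_algebra borel)"
    and disintegration: "\<And>B A. B \<in> sets borel \<Longrightarrow> B \<subseteq> {0..} \<Longrightarrow> A \<in> sets borel \<Longrightarrow>
      emeasure (intensity M T X) (B \<times> A) = (\<integral>\<^sup>+t\<in>B. emeasure (Q t) A \<partial>marginal_intensity M T X)"
    and outer_minkowski: "\<And>t A. 0 \<le> t \<Longrightarrow> bounded A \<Longrightarrow> A \<in> sets borel \<Longrightarrow>
      emeasure lborel (frontier A) = 0 \<Longrightarrow>
      ((\<lambda>r. (\<integral>\<^sup>+\<omega>. emeasure lborel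
               ((enlargement (grain_union T X \<Theta> t \<omega>) r - grain_union T X \<Theta> t \<omega>) \<inter> A) \<partial>M) / ennreal r)
        \<longlongrightarrow> (\<integral>\<^sup>+\<omega>. hausdorff_measure (DIM('a) - 1) (frontier (grain_union T X \<Theta> t \<omega>) \<inter> A) \<partial>M))
        (at_right 0)"
    and A1: "\<And>t. 0 < t \<Longrightarrow>
      ((\<lambda>h. (\<integral>\<^sup>+\<omega>. emeasure (marginal_process T X \<omega>) {t..t + h} *
                indicator {\<omega>. 2 \<le> emeasure (marginal_process T X \<omega>) {t..t + h}} \<omega> \<partial>M) / ennreal h)
        \<longlongrightarrow> 0) (at_right 0)"
    and A2_locally_finite: "\<And>K. compact K \<Longrightarrow> emeasure (marginal_intensity M T X) K < \<infinity>"
    and A2_time: "\<exists>f\<in>borel_measurable lborel. marginal_intensity M T X = density lborel f"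
    and A2_mark: "\<And>t. 0 < t \<Longrightarrow> \<exists>q\<in>borel_measurable lborel. Q t = density lborel q"

end

theory Submission
  imports Defs
begin

text \<open>Both sides of the identity equal \<open>\<Sum>j. P (x \<in> \<Theta>\<^sup>t\<^sub>j)\<close>, where \<open>\<Theta>\<^sup>t\<^sub>j\<close> is the \<open>j\<close>-th grain
  at time \<open>t\<close> (empty if the nucleus is not yet born). For the intensity measure this is Campbell's
  formula applied to the causal cone: the nucleus \<open>(T\<^sub>j, X\<^sub>j)\<close> lies in the cone of \<open>(t, x)\<close> exactly
  when the \<open>j\<close>-th grain covers \<open>x\<close> at time \<open>t\<close>; this holds for every \<open>x\<close>
  (\<open>emeasure_intensity_causal_cone\<close>). For the extended volume it is Robbins' formula
  \<open>E[\<H>\<^sup>d(F \<inter> A)] = \<integral>\<^sub>A P (x \<in> F) dx\<close> for a random closed set \<open>F\<close> (\<open>nn_integral_volume_random_closed_set\<close>),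
  summed over \<open>j\<close>. So \<open>V\<^sub>e\<^sub>x t\<close> and \<open>x \<mapsto> \<Lambda>(\<C>(t, x))\<close> have the same integral over every Borel set,
  and two densities with respect to the \<open>\<sigma>\<close>-finite Lebesgue measure with this property agree
  almost everywhere.

  The analytic content is the joint measurability of \<open>(\<omega>, x) \<mapsto> 1 {x \<in> F(\<omega>)}\<close> needed for Tonelli's
  theorem. It is derived from the hitting events of compact balls
  (\<open>measurable_mem_random_closed_set\<close>), so that no joint measurability of \<open>\<Theta>\<close> in all of its
  arguments is used.\<close>

text \<open>A point lies outside a closed set iff it lies in one of countably many small balls whose
  closure misses the set. This exhibits the complement of the graph as a countable union of
  measurable rectangles.\<close>

lemma measurable_mem_random_closed_set:
  fixes F :: "'w \<Rightarrow> 'a::euclidean_space set"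
  assumes F: "random_closed_set M F" and closed: "\<And>\<omega>. \<omega> \<in> space M \<Longrightarrow> closed (F \<omega>)"
  shows "Measurable.pred (M \<Otimes>\<^sub>M borel) (\<lambda>(\<omega>, x). x \<in> F \<omega>)"
proof -
  obtain D :: "'a set" where "countable D"
    and D: "\<And>U. open U \<Longrightarrow> U \<noteq> {} \<Longrightarrow> \<exists>d\<in>D. d \<in> U"
    using countable_dense_setE by metis
  have miss: "Measurable.pred M (\<lambda>\<omega>. F \<omega> \<inter> cball q r = {})" for q r
  proof -
    have "Measurable.pred M (\<lambda>\<omega>. F \<omega> \<inter> cball q r \<noteq> {})"
      using F compact_cball[of q r] by (simp add: pred_def random_closed_set_def)
    from pred_intros_logic(2)[OF this] show ?thesis by simp
  qed
  have outside: "x \<notin> F \<omega> \<longleftrightarrow>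
      (\<exists>q\<in>D. \<exists>n. F \<omega> \<inter> cball q (1 / real (Suc n)) = {} \<and> x \<in> ball q (1 / real (Suc n)))"
    if \<omega>: "\<omega> \<in> space M" for \<omega> x
  proof
    assume "x \<notin> F \<omega>"
    with closed[OF \<omega>] obtain e where "e > 0" and e: "ball x e \<subseteq> - F \<omega>"
      by (metis ComplI open_Compl openE)
    obtain n where n: "1 / real (Suc n) < e / 2"
      using \<open>e > 0\<close> nat_approx_posE[of "e / 2"] by auto
    obtain q where "q \<in> D" and q: "q \<in> ball x (1 / real (Suc n))"
      using D[of "ball x (1 / real (Suc n))"] by auto
    have "cball q (1 / real (Suc n)) \<subseteq> ball x e"
    proof
      fix y assume "y \<in> cball q (1 / real (Suc n))"
      then show "y \<in> ball x e"
        using q n dist_triangle[of x y q] unfolding mem_ball mem_cball by linarith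
    qed
    with e q \<open>q \<in> D\<close>
    show "\<exists>q\<in>D. \<exists>n. F \<omega> \<inter> cball q (1 / real (Suc n)) = {} \<and> x \<in> ball q (1 / real (Suc n))"
      by (intro bexI[of _ q] exI[of _ n] conjI) (blast, simp add: dist_commute)
  next
    assume "\<exists>q\<in>D. \<exists>n. F \<omega> \<inter> cball q (1 / real (Suc n)) = {} \<and> x \<in> ball q (1 / real (Suc n))"
    then obtain q n where "F \<omega> \<inter> cball q (1 / real (Suc n)) = {}" "x \<in> ball q (1 / real (Suc n))"
      by blast
    then show "x \<notin> F \<omega>"
      using ball_subset_cball[of q "1 / real (Suc n)"] by blast
  qed
  have "Measurable.pred (M \<Otimes>\<^sub>M borel) (\<lambda>p. F (fst p) \<inter> cball q r = {})" for q r
    using miss by (rule measurable_compose[OF measurable_fst])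
  moreover have "Measurable.pred (M \<Otimes>\<^sub>M borel) (\<lambda>p. snd p \<in> ball q r)" for q :: 'a and r
    by (rule measurable_compose[OF measurable_snd]) (simp add: pred_def)
  ultimately
  have "Measurable.pred (M \<Otimes>\<^sub>M borel) (\<lambda>p. \<not> (\<exists>q\<in>D. \<exists>n.
      F (fst p) \<inter> cball q (1 / real (Suc n)) = {} \<and> snd p \<in> ball q (1 / real (Suc n))))"
    using \<open>countable D\<close> unfolding pred_def
    by (intro sets.sets_Collect sets.sets_Collect_countable_Ex sets.sets_Collect_countable_Ex')
  then show ?thesis
    by (rule measurable_cong[THEN iffD1, rotated])
       (simp only: space_pair_measure case_prod_beta mem_Times_iff outside[symmetric] not_not)
qed

lemma nn_integral_volume_random_closed_set:
  fixes F :: "'w \<Rightarrow> 'a::euclidean_space set"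
  assumes "sigma_finite_measure M"
    and F: "random_closed_set M F" and closed: "\<And>\<omega>. \<omega> \<in> space M \<Longrightarrow> closed (F \<omega>)"
    and A: "A \<in> sets borel"
  shows "(\<integral>\<^sup>+\<omega>. emeasure lborel (F \<omega> \<inter> A) \<partial>M) =
    (\<integral>\<^sup>+x\<in>A. emeasure M {\<omega> \<in> space M. x \<in> F \<omega>} \<partial>lborel)"
proof -
  interpret M: sigma_finite_measure M by fact
  interpret P: pair_sigma_finite M "lborel :: 'a measure" ..
  note measurable_mem_random_closed_set[OF F closed, measurable]
  note A[measurable]
  have slice: "{\<omega> \<in> space M. x \<in> F \<omega>} \<in> sets M" for x
    by measurable
  have "(\<integral>\<^sup>+\<omega>. emeasure lborel (F \<omega> \<inter> A) \<partial>M) =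
      (\<integral>\<^sup>+\<omega>. (\<integral>\<^sup>+x. indicator {p. snd p \<in> F (fst p) \<and> snd p \<in> A} (\<omega>, x) \<partial>lborel) \<partial>M)"
  proof (intro nn_integral_cong)
    fix \<omega> assume "\<omega> \<in> space M"
    have "(\<integral>\<^sup>+x. indicator {p. snd p \<in> F (fst p) \<and> snd p \<in> A} (\<omega>, x) \<partial>lborel) =
        (\<integral>\<^sup>+x. indicator (F \<omega> \<inter> A) x \<partial>lborel)"
      by (intro nn_integral_cong) (simp add: indicator_def)
    also have "\<dots> = emeasure lborel (F \<omega> \<inter> A)"
      using closed[OF \<open>\<omega> \<in> space M\<close>] A by (intro nn_integral_indicator) auto
    finally show "emeasure lborel (F \<omega> \<inter> A) =
        (\<integral>\<^sup>+x. indicator {p. snd p \<in> F (fst p) \<and> snd p \<in> A} (\<omega>, x) \<partial>lborel)" ..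
  qed
  also have "\<dots> =
      (\<integral>\<^sup>+x. (\<integral>\<^sup>+\<omega>. indicator {p. snd p \<in> F (fst p) \<and> snd p \<in> A} (\<omega>, x) \<partial>M) \<partial>lborel)"
  proof (rule P.Fubini'[symmetric])
    have "Measurable.pred (M \<Otimes>\<^sub>M lborel) (\<lambda>p. snd p \<in> F (fst p) \<and> snd p \<in> A)"
      using measurable_mem_random_closed_set[OF F closed] by (simp add: case_prod_beta)
    then have "(\<lambda>p. if snd p \<in> F (fst p) \<and> snd p \<in> A then 1 else 0 :: ennreal)
        \<in> borel_measurable (M \<Otimes>\<^sub>M lborel)"
      by measurable
    then show "(\<lambda>(\<omega>, x). indicator {p. snd p \<in> F (fst p) \<and> snd p \<in> A} (\<omega>, x) :: ennreal)
        \<in> borel_measurable (M \<Otimes>\<^sub>M lborel)"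
      by (simp add: indicator_def case_prod_beta)
  qed
  also have "\<dots> = (\<integral>\<^sup>+x\<in>A. emeasure M {\<omega> \<in> space M. x \<in> F \<omega>} \<partial>lborel)"
  proof (intro nn_integral_cong)
    fix x
    have "(\<integral>\<^sup>+\<omega>. indicator {p. snd p \<in> F (fst p) \<and> snd p \<in> A} (\<omega>, x) \<partial>M) =
        (\<integral>\<^sup>+\<omega>. indicator {\<omega> \<in> space M. x \<in> F \<omega>} \<omega> * indicator A x \<partial>M)"
      by (intro nn_integral_cong) (simp add: indicator_def)
    also have "\<dots> = emeasure M {\<omega> \<in> space M. x \<in> F \<omega>} * indicator A x"
      using slice by (simp add: nn_integral_multc)
    finally show "(\<integral>\<^sup>+\<omega>. indicator {p. snd p \<in> F (fst p) \<and> snd p \<in> A} (\<omega>, x) \<partial>M) =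
        emeasure M {\<omega> \<in> space M. x \<in> F \<omega>} * indicator A x" .
  qed
  finally show ?thesis .
qed

context birth_and_growth
begin

lemma closed_grain: "closed (grain T X \<Theta> j t \<omega>)"
proof (cases "T j \<omega> \<le> ennreal t")
  case True
  show ?thesis
  proof (cases "0 \<le> t")
    case True
    with \<open>T j \<omega> \<le> ennreal t\<close> show ?thesis
      by (auto simp: grain_def intro!: grain_closed enn2real_leI)
  next
    case False
    \<comment> \<open>Here \<open>ennreal t = 0\<close>, so the birth time is \<open>0 > t\<close>.\<close>
    with \<open>T j \<omega> \<le> ennreal t\<close> show ?thesis
      by (simp add: grain_def ennreal_neg grain_unborn)
  qed
qed (simp add: grain_def)

lemma mem_grain_iff_causal_cone:
  assumes "0 \<le> t"
  shows "x \<in> grain T X \<Theta> j t \<omega> \<longleftrightarrow>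
    T j \<omega> < \<infinity> \<and> (enn2real (T j \<omega>), X j \<omega>) \<in> causal_cone \<Theta> t x"
  using assms
  by (cases "T j \<omega>") (auto simp: grain_def causal_cone_def ennreal_le_iff top_unique)

lemma measurable_mem_grain:
  assumes "0 \<le> t"
  shows "Measurable.pred (M \<Otimes>\<^sub>M borel) (\<lambda>(\<omega>, x). x \<in> grain T X \<Theta> j t \<omega>)"
  using assms by (intro measurable_mem_random_closed_set grain_random_closed closed_grain)

lemma sets_mem_grain:
  assumes "0 \<le> t"
  shows "{\<omega> \<in> space M. x \<in> grain T X \<Theta> j t \<omega>} \<in> sets M"
proof -
  note measurable_mem_grain[OF assms, measurable]
  show ?thesis by measurable
qed

lemma borel_measurable_coverage:
  assumes "0 \<le> t"
  shows "(\<lambda>x. emeasure M {\<omega> \<in> space M. x \<in> grain T X \<Theta> j t \<omega>}) \<in> borel_measurable borel"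
proof -
  interpret P: pair_sigma_finite M "lborel :: 'a measure" ..
  let ?G = "{p \<in> space (M \<Otimes>\<^sub>M borel). snd p \<in> grain T X \<Theta> j t (fst p)}"
  have "?G \<in> sets (M \<Otimes>\<^sub>M lborel)"
    using measurable_mem_grain[OF assms, of j]
    by (simp add: pred_def case_prod_beta cong: sets_pair_measure_cong)
  from P.measurable_emeasure_Pair2[OF this] show ?thesis
    by (simp add: space_pair_measure vimage_def)
qed

text \<open>Campbell's formula for the indicator of the causal cone.\<close>

lemma emeasure_intensity_causal_cone:
  assumes "0 \<le> t"
  shows "emeasure (intensity M T X) (causal_cone \<Theta> t x) =
    (\<Sum>j. emeasure M {\<omega> \<in> space M. x \<in> grain T X \<Theta> j t \<omega>})"
proof -
  have "emeasure (intensity M T X) (causal_cone \<Theta> t x) =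
      (\<integral>\<^sup>+\<omega>. (\<Sum>j. indicator {\<omega> \<in> space M. x \<in> grain T X \<Theta> j t \<omega>} \<omega>) \<partial>M)"
    using causal_cone_borel[OF assms]
    by (simp add: emeasure_intensity emeasure_nucleation mem_grain_iff_causal_cone[OF assms]
        indicator_def cong: nn_integral_cong)
  also have "\<dots> = (\<Sum>j. emeasure M {\<omega> \<in> space M. x \<in> grain T X \<Theta> j t \<omega>})"
    using sets_mem_grain[OF assms] by (subst nn_integral_suminf) auto
  finally show ?thesis .
qed

lemma mean_extended_volume_density_causal_cone:
  assumes t: "0 \<le> t"
  shows "mean_extended_volume_density M T X \<Theta> t
    (\<lambda>x. emeasure (intensity M T X) (causal_cone \<Theta> t x))"
  unfolding mean_extended_volume_density_def
proof (intro conjI ballI)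
  note coverage = borel_measurable_coverage[OF t]
  show "(\<lambda>x. emeasure (intensity M T X) (causal_cone \<Theta> t x)) \<in> borel_measurable borel"
    using coverage by (simp add: emeasure_intensity_causal_cone[OF t])
  fix A :: "'a set" assume A: "A \<in> sets borel"
  have volume: "(\<lambda>\<omega>. emeasure lborel (grain T X \<Theta> j t \<omega> \<inter> A)) \<in> borel_measurable M" for j
  proof -
    have "{p \<in> space (M \<Otimes>\<^sub>M lborel). snd p \<in> grain T X \<Theta> j t (fst p) \<and> snd p \<in> A}
        \<in> sets (M \<Otimes>\<^sub>M lborel)" (is "?G \<in> _")
    proof -
      have "Measurable.pred (M \<Otimes>\<^sub>M lborel) (\<lambda>p. snd p \<in> grain T X \<Theta> j t (fst p) \<and> snd p \<in> A)"
        using measurable_mem_grain[OF t] A by (simp add: case_prod_beta)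
      then show ?thesis by (simp add: pred_def)
    qed
    from lborel.measurable_emeasure_Pair[OF this]
    have "(\<lambda>\<omega>. emeasure lborel (Pair \<omega> -` ?G)) \<in> borel_measurable M" .
    then show ?thesis
      by (rule measurable_cong[THEN iffD1, rotated])
         (auto simp: space_pair_measure intro!: arg_cong[where f = "emeasure _"])
  qed
  have "(\<integral>\<^sup>+\<omega>. (\<Sum>j. emeasure lborel (grain T X \<Theta> j t \<omega> \<inter> A)) \<partial>M) =
      (\<Sum>j. \<integral>\<^sup>+\<omega>. emeasure lborel (grain T X \<Theta> j t \<omega> \<inter> A) \<partial>M)"
    using volume by (intro nn_integral_suminf)
  also have "\<dots> = (\<Sum>j. \<integral>\<^sup>+x\<in>A. emeasure M {\<omega> \<in> space M. x \<in> grain T X \<Theta> j t \<omega>} \<partial>lborel)"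
    using grain_random_closed[OF t] closed_grain A sigma_finite_measure_axioms
    by (simp add: nn_integral_volume_random_closed_set)
  also have "\<dots> = (\<integral>\<^sup>+x\<in>A. (\<Sum>j. emeasure M {\<omega> \<in> space M. x \<in> grain T X \<Theta> j t \<omega>}) \<partial>lborel)"
    using coverage A by (subst nn_integral_suminf[symmetric]) auto
  finally show "(\<integral>\<^sup>+\<omega>. (\<Sum>j. emeasure lborel (grain T X \<Theta> j t \<omega> \<inter> A)) \<partial>M) =
      (\<integral>\<^sup>+x\<in>A. emeasure (intensity M T X) (causal_cone \<Theta> t x) \<partial>lborel)"
    by (simp add: emeasure_intensity_causal_cone[OF t])
qed

end

lemma mean_extended_volume_density_AE_unique:
  assumes V: "mean_extended_volume_density M T X \<Theta> t V"
    and W: "mean_extended_volume_density M T X \<Theta> t W"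
  shows "AE x in lborel. V x = W x"
proof -
  have meas: "V \<in> borel_measurable lborel" "W \<in> borel_measurable lborel"
    using V W by (auto simp: mean_extended_volume_density_def)
  have "density lborel V = density lborel W"
    using V W meas
    by (intro measure_eqI) (auto simp: emeasure_density mean_extended_volume_density_def)
  then show ?thesis
    using sigma_finite_measure.density_unique[OF sigma_finite_lborel meas] by simp
qed

theorem proposition3p4:
  fixes M :: "'w measure"
    and T :: "nat \<Rightarrow> 'w \<Rightarrow> ennreal"
    and X :: "nat \<Rightarrow> 'w \<Rightarrow> real ^ 'd"
    and \<Theta> :: "real \<Rightarrow> real \<Rightarrow> real ^ 'd \<Rightarrow> (real ^ 'd) set"
    and G :: "real \<Rightarrow> real ^ 'd \<Rightarrow> real"
    and Q :: "real \<Rightarrow> (real ^ 'd) measure"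
    and V\<^sub>e\<^sub>x :: "real \<Rightarrow> real ^ 'd \<Rightarrow> ennreal"
  assumes "CARD('d) \<ge> 2"
    and "class_G M T X \<Theta> G Q"
    and "\<And>t. 0 \<le> t \<Longrightarrow> mean_extended_volume_density M T X \<Theta> t (V\<^sub>e\<^sub>x t)"
  shows "\<forall>t\<ge>0. AE x in lborel. V\<^sub>e\<^sub>x t x = emeasure (intensity M T X) (causal_cone \<Theta> t x)"
proof (intro allI impI)
  interpret class_G M T X \<Theta> G Q by fact
  fix t :: real assume t: "0 \<le> t"
  show "AE x in lborel. V\<^sub>e\<^sub>x t x = emeasure (intensity M T X) (causal_cone \<Theta> t x)"
    using assms(3)[OF t] mean_extended_volume_density_causal_cone[OF t]
    by (rule mean_extended_volume_density_AE_unique)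
qed

end
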